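(* Let $c>0$ be a fixed real number. Then, for all positive integers $n,k$ such that $k(k-1)+1.13\,c^2\le\chi_n(c)$, we have $$|\beta_0^n|\le\frac1{\sqrt2}|\mu_n(c)|\qquad\text{and}\qquad|\beta_k^n|\le\sqrt{\frac5{4\pi}}\left(\frac2{\sqrt q}\right)^k|\mu_n(c)|,$$ where $q=c^2/\chi_n(c)$.
   Context: For $c>0$, the prolate spheroidal wave functions (PSWFs) $\psi_n=\psi_{n,c}$, $n\ge0$, are the real-valued eigenfunctions, smooth on $[-1,1]$, of the Sturm–Liouville operator $$\mathcal L_c(\psi)=-\frac{d}{dx}\left[(1-x^2)\frac{d\psi}{dx}\right]+c^2x^2\psi,\qquad \mathcal L_c\psi_n=\chi_n(c)\psi_n,$$ with eigenvalues arranged in increasing order $\chi_0(c)<\chi_1(c)<\cdots$, normalized by $\int_{-1}^1|\psi_n|^2=1$. They form an orthonormal basis of $L^2([-1,1])$, and $\psi_n$ has the same parity as $n$. The sign is normalized by $\psi_n(0)>0$ for even $n$ and $\psi_n'(0)>0$ for odd $n$. They are also eigenfunctions of the finite Fourier transform $\mathcal F_c(f)(x)=\int_{-1}^1e^{icxy}f(y)\,dy$ on $L^2([-1,1])$, and $\mu_n(c)$ denotes the corresponding eigenvalue: $\mathcal F_c\psi_n=\mu_n(c)\psi_n$. The coefficients $\beta_k^n$ are the Legendre expansion coefficients of $\psi_n$: $\psi_n=\sum_{k\ge0}\beta_k^n\overline{P_k}$, i.e. $\beta_k^n=\int_{-1}^1\psi_n(x)\overline{P_k}(x)\,dx$, where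 $\overline{P_k}=\sqrt{k+1/2}\,P_k$ is the $L^2([-1,1])$-normalized Legendre polynomial of degree $k$ (the bar is not complex conjugation). *)

theory Defs
  imports "HOL-Analysis.Analysis" "HOL-Computational_Algebra.Polynomial"
begin

text \<open>Rodrigues' formula\<close>

definition legendre_poly :: "nat \<Rightarrow> real poly" where
  "legendre_poly k = smult (1 / (2 ^ k * fact k)) ((pderiv ^^ k) ([:-1, 0, 1:] ^ k))"

definition legendre_normalized :: "nat \<Rightarrow> real \<Rightarrow> real" where
  "legendre_normalized k x = sqrt (real k + 1/2) * poly (legendre_poly k) x"

text \<open>Functions on \<open>[-1,1]\<close> are represented by functions on the reals whose values outside
  \<open>[-1,1]\<close> are irrelevant; accordingly, derivatives are one-sided at \<open>-1\<close> and \<open>1\<close>.\<close>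

definition Dseg :: "(real \<Rightarrow> real) \<Rightarrow> real \<Rightarrow> real" where
  "Dseg f x = vector_derivative f (at x within {-1..1})"

definition smooth_seg :: "(real \<Rightarrow> real) \<Rightarrow> bool" where
  "smooth_seg f \<longleftrightarrow> (\<forall>j. (Dseg ^^ j) f differentiable_on {-1..1})"

definition sturm_liouville :: "real \<Rightarrow> (real \<Rightarrow> real) \<Rightarrow> real \<Rightarrow> real" where
  "sturm_liouville c f x = - Dseg (\<lambda>t. (1 - t\<^sup>2) * Dseg f t) x + c\<^sup>2 * x\<^sup>2 * f x"

definition sl_eigenfunction :: "real \<Rightarrow> real \<Rightarrow> (real \<Rightarrow> real) \<Rightarrow> bool" where
  "sl_eigenfunction c l f \<longleftrightarrow> smooth_seg f \<and> (\<exists>x\<in>{-1..1}. f x \<noteq> 0) \<and>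
     (\<forall>x\<in>{-1..1}. sturm_liouville c f x = l * f x)"

text \<open>\<open>strict_mono\<close> together with the range condition says that \<open>chi\<close> lists all the
  eigenvalues in increasing order.\<close>

definition pswf_system :: "real \<Rightarrow> (nat \<Rightarrow> real) \<Rightarrow> (nat \<Rightarrow> real \<Rightarrow> real) \<Rightarrow> bool" where
  "pswf_system c chi psi \<longleftrightarrow>
     strict_mono chi \<and> range chi = {l. \<exists>f. sl_eigenfunction c l f} \<and>
     (\<forall>n. sl_eigenfunction c (chi n) (psi n) \<and>
          integral {-1..1} (\<lambda>x. \<bar>psi n x\<bar>\<^sup>2) = 1 \<and>
          (even n \<longrightarrow> psi n 0 > 0) \<and> (odd n \<longrightarrow> Dseg (psi n) 0 > 0))"

definition finite_fourier :: "real \<Rightarrow> (real \<Rightarrow> complex) \<Rightarrow> real \<Rightarrow> complex" where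
  "finite_fourier c f x = integral {-1..1} (\<lambda>y. exp (\<i> * of_real (c * x * y)) * f y)"

definition legendre_coeff :: "(real \<Rightarrow> real) \<Rightarrow> nat \<Rightarrow> real" where
  "legendre_coeff f k = integral {-1..1} (\<lambda>x. f x * legendre_normalized k x)"

end

theory Submission
  imports Defs
begin

text \<open>
  Integrating the Sturm-Liouville equation against \<open>P\<^sub>m\<close> and expanding \<open>x\<^sup>2 P\<^sub>m\<close> gives a three-term
  recurrence for the integrals \<open>I\<^sub>m = \<integral> \<psi> P\<^sub>m\<close>. The coefficients of \<open>x\<^sup>2 P\<^sub>m\<close> are
  nonnegative and sum to 1 (evaluate at 1), so as long as \<open>m (m + 1) + c\<^sup>2 \<le> \<chi>\<close>
  the integrals of equal parity have the same sign and increase in modulus; dropping the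
  nonnegative terms, they grow at most by the factor \<open>\<chi> / (c\<^sup>2 a)\<close>, where \<open>a\<close> is the coefficient of
  \<open>P\<^sub>m\<^sub>+\<^sub>2\<close>. The initial values \<open>I\<^sub>0\<close> and \<open>I\<^sub>1\<close> are \<open>\<mu> \<psi>(0)\<close> and \<open>\<mu> \<psi>'(0) / (\<i> c)\<close>,
  and \<open>\<psi>(0)\<^sup>2 + \<psi>'(0)\<^sup>2 / \<chi> \<le> 1\<close> because the energy
  \<open>(1 - x\<^sup>2) (1 - q x\<^sup>2) \<psi>\<^sup>2 + (1 - x\<^sup>2)\<^sup>2 \<psi>'\<^sup>2 / \<chi>\<close> vanishes at the
  endpoints and, as \<open>q = c\<^sup>2 / \<chi> \<le> 1\<close>, has a derivative of modulus at most \<open>2 \<psi>\<^sup>2\<close>.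
\<close>

section \<open>Legendre polynomials\<close>

text \<open>Leibniz' rule breaks off after two terms because X has no second derivative. Counting by
  \<open>Suc n\<close> keeps the order \<open>n\<close> of the last term free of truncated
  subtraction.\<close>

lemma higher_pderiv_X_mult:
  "(pderiv ^^ Suc n) ([:0, 1:] * p) =
     [:0, 1:] * (pderiv ^^ Suc n) p + of_nat (Suc n) * (pderiv ^^ n) (p :: real poly)"
proof (induction n)
  case 0
  then show ?case by (simp add: pderiv_mult pderiv_pCons)
next
  case (Suc n)
  have "(pderiv ^^ Suc (Suc n)) ([:0, 1:] * p) = pderiv ((pderiv ^^ Suc n) ([:0, 1:] * p))"
    by simp
  also have "\<dots> = pderiv ([:0, 1:] * (pderiv ^^ Suc n) p + of_nat (Suc n) * (pderiv ^^ n) p)"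
    by (simp only: Suc.IH)
  also have "\<dots> = [:0, 1:] * (pderiv ^^ Suc (Suc n)) p + of_nat (Suc (Suc n)) * (pderiv ^^ Suc n) p"
    by (simp add: pderiv_add pderiv_mult pderiv_pCons algebra_simps del: mult_pCons_left)
  finally show ?case .
qed

lemma pderiv_legendre_base:
  "pderiv ([:-1, 0, 1:] ^ Suc k) = smult (2 * real (Suc k)) ([:0, 1:] * [:-1, 0, 1:] ^ k)"
proof -
  have "pderiv [:-1, 0, 1::real:] = smult 2 [:0, 1:]"
    by (simp add: pderiv_pCons)
  then show ?thesis
    by (simp only: pderiv_power_Suc mult_smult_right smult_smult mult_smult_left mult.commute)
qed

text \<open>Writing x^2 = u + 1 with u = x^2 - 1 brings the second derivative back to pure powers of
  u, so that \<open>k\<close> further derivatives are again of Rodrigues type.\<close>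

lemma pderiv2_legendre_base:
  "pderiv (pderiv ([:-1, 0, 1:] ^ Suc (Suc k))) =
     smult (2 * real (Suc (Suc k)))
       (smult (real (2 * k + 3)) ([:-1, 0, 1:] ^ Suc k) + smult (2 * real (Suc k)) ([:-1, 0, 1:] ^ k))"
proof -
  define u :: "real poly" where "u = [:-1, 0, 1:]"
  have X2: "[:0, 1:] * ([:0, 1:] * u ^ k) = u ^ Suc k + u ^ k"
  proof -
    have "[:0, 1:] * [:0, 1:] = u + 1" by (simp add: u_def one_pCons)
    then show ?thesis by (metis mult.assoc distrib_right mult_1 power_Suc)
  qed
  have "pderiv (pderiv (u ^ Suc (Suc k))) = smult (2 * real (Suc (Suc k))) (pderiv ([:0, 1:] * u ^ Suc k))"
    by (simp only: pderiv_legendre_base u_def pderiv_smult)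
  also have "pderiv ([:0, 1:] * u ^ Suc k) = u ^ Suc k + [:0, 1:] * smult (2 * real (Suc k)) ([:0, 1:] * u ^ k)"
    unfolding pderiv_mult unfolding u_def pderiv_legendre_base
    by (simp add: pderiv_pCons del: mult_pCons_left)
  also have "\<dots> = u ^ Suc k + smult (2 * real (Suc k)) (u ^ Suc k + u ^ k)"
    by (simp only: mult_smult_right X2)
  also have "\<dots> = smult (1 + 2 * real (Suc k)) (u ^ Suc k) + smult (2 * real (Suc k)) (u ^ k)"
    by (simp only: smult_add_left smult_add_right smult_1_left add.assoc)
  finally show ?thesis by (simp add: u_def add.commute)
qed

text \<open>Rodrigues' formula for P_(k+1) with one derivative fewer. This is the antiderivative of
  P_(k+1) that vanishes at -1 and 1.\<close>

definition legendre_antideriv :: "nat \<Rightarrow> real poly" where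
  "legendre_antideriv k = smult (1 / (2 ^ Suc k * fact (Suc k))) ((pderiv ^^ k) ([:-1, 0, 1:] ^ Suc k))"

lemma pderiv_legendre_antideriv: "pderiv (legendre_antideriv k) = legendre_poly (Suc k)"
  by (simp add: legendre_antideriv_def legendre_poly_def pderiv_smult)

text \<open>One derivative of u^(k+2), with u = x^2 - 1, is a multiple of x u^(k+1). Leibniz' rule
  handles the remaining \<open>k + 1\<close> derivatives.\<close>

lemma legendre_Suc_Suc_eq_antideriv:
  "legendre_poly (Suc (Suc k)) =
     [:0, 1:] * legendre_poly (Suc k) + smult (real (Suc k)) (legendre_antideriv k)"
proof -
  have of_nat: "of_nat n * p = smult (real n) p" for n and p :: "real poly"
    by (simp add: of_nat_poly)
  have "(pderiv ^^ Suc (Suc k)) ([:-1, 0, 1:] ^ Suc (Suc k)) =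
      (pderiv ^^ Suc k) (smult (2 * real (Suc (Suc k))) ([:0, 1:] * [:-1, 0, 1:] ^ Suc k))"
    unfolding funpow_Suc_right o_apply unfolding pderiv_legendre_base ..
  also have "\<dots> = smult (2 * real (Suc (Suc k)))
      ([:0, 1:] * (pderiv ^^ Suc k) ([:-1, 0, 1:] ^ Suc k) +
       smult (real (Suc k)) ((pderiv ^^ k) ([:-1, 0, 1:] ^ Suc k)))"
    unfolding higher_pderiv_smult higher_pderiv_X_mult
    by (simp only: of_nat)
  finally have "legendre_poly (Suc (Suc k)) =
     smult (1 / (2 ^ Suc (Suc k) * fact (Suc (Suc k))) * (2 * real (Suc (Suc k))))
      ([:0, 1:] * (pderiv ^^ Suc k) ([:-1, 0, 1:] ^ Suc k) +
       smult (real (Suc k)) ((pderiv ^^ k) ([:-1, 0, 1:] ^ Suc k)))"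
    unfolding legendre_poly_def by (simp only: smult_smult)
  also have "1 / (2 ^ Suc (Suc k) * fact (Suc (Suc k))) * (2 * real (Suc (Suc k))) =
      1 / (2 ^ Suc k * fact (Suc k))"
    by (subst fact_Suc) (simp del: fact_Suc of_nat_Suc)
  finally show ?thesis
    unfolding legendre_poly_def legendre_antideriv_def
    by (simp only: smult_add_right mult_smult_right smult_smult mult.commute)
qed

text \<open>Here the two innermost derivatives of Rodrigues' formula are carried out, which leaves
  \<open>k\<close> derivatives of u^(k+1) and u^k.\<close>

lemma legendre_Suc_Suc_diff:
  "legendre_poly (Suc (Suc k)) = smult (real (2 * k + 3)) (legendre_antideriv k) + legendre_poly k"
proof -
  have "(pderiv ^^ Suc (Suc k)) ([:-1, 0, 1:] ^ Suc (Suc k)) =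
      (pderiv ^^ k) (pderiv (pderiv ([:-1, 0, 1:] ^ Suc (Suc k))))"
    unfolding funpow_Suc_right o_apply ..
  also have "\<dots> = smult (2 * real (Suc (Suc k)))
      (smult (real (2 * k + 3)) ((pderiv ^^ k) ([:-1, 0, 1:] ^ Suc k)) +
       smult (2 * real (Suc k)) ((pderiv ^^ k) ([:-1, 0, 1:] ^ k)))"
    unfolding pderiv2_legendre_base higher_pderiv_smult higher_pderiv_add ..
  finally have "legendre_poly (Suc (Suc k)) =
     smult (1 / (2 ^ Suc (Suc k) * fact (Suc (Suc k))) * (2 * real (Suc (Suc k))))
      (smult (real (2 * k + 3)) ((pderiv ^^ k) ([:-1, 0, 1:] ^ Suc k)) +
       smult (2 * real (Suc k)) ((pderiv ^^ k) ([:-1, 0, 1:] ^ k)))"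
    unfolding legendre_poly_def by (simp only: smult_smult)
  also have "1 / (2 ^ Suc (Suc k) * fact (Suc (Suc k))) * (2 * real (Suc (Suc k))) =
      1 / (2 ^ Suc k * fact (Suc k))"
    by (subst fact_Suc) (simp del: fact_Suc of_nat_Suc)
  also have "smult (1 / (2 ^ Suc k * fact (Suc k)))
      (smult (real (2 * k + 3)) ((pderiv ^^ k) ([:-1, 0, 1:] ^ Suc k)) +
       smult (2 * real (Suc k)) ((pderiv ^^ k) ([:-1, 0, 1:] ^ k))) =
     smult (real (2 * k + 3)) (legendre_antideriv k) +
     smult (1 / (2 ^ Suc k * fact (Suc k)) * (2 * real (Suc k))) ((pderiv ^^ k) ([:-1, 0, 1:] ^ k))"
    unfolding legendre_antideriv_def by (simp only: smult_add_right smult_smult mult.commute)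
  also have "1 / (2 ^ Suc k * fact (Suc k)) * (2 * real (Suc k)) = 1 / (2 ^ k * fact k)"
    by (subst fact_Suc) (simp del: fact_Suc of_nat_Suc)
  finally show ?thesis by (simp only: legendre_poly_def)
qed

lemma legendre_poly_0 [simp]: "legendre_poly 0 = 1"
  by (simp add: legendre_poly_def)

lemma legendre_poly_1 [simp]: "legendre_poly (Suc 0) = [:0, 1:]"
  by (simp add: legendre_poly_def pderiv_pCons)

text \<open>Eliminating the antiderivative from the two preceding formulas for P_(k+2) gives the
  case \<open>n = k + 1\<close>. For \<open>n = 0\<close> the truncated index \<open>n - 1\<close>
  has coefficient 0.\<close>

lemma poly_legendre_bonnet:
  "(real n + 1) * poly (legendre_poly (n + 1)) x =
     (2 * real n + 1) * x * poly (legendre_poly n) x - real n * poly (legendre_poly (n - 1)) x"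
proof (cases n)
  case (Suc k)
  define G where "G = poly (legendre_antideriv k) x"
  have "poly (legendre_poly (Suc (Suc k))) x = x * poly (legendre_poly (Suc k)) x + (real k + 1) * G"
    by (simp add: G_def legendre_Suc_Suc_eq_antideriv)
  moreover have "poly (legendre_poly (Suc (Suc k))) x = (2 * real k + 3) * G + poly (legendre_poly k) x"
    by (simp add: G_def legendre_Suc_Suc_diff)
  ultimately show ?thesis unfolding Suc
    by simp algebra
qed simp

text \<open>For \<open>m < 2\<close> the term with the truncated index \<open>m - 2\<close> has coefficient 0.\<close>

lemma poly_X_sq_legendre:
  "x\<^sup>2 * poly (legendre_poly m) x =
     (real m + 1) * (real m + 2) / ((2 * real m + 1) * (2 * real m + 3)) * poly (legendre_poly (m + 2)) x +
     ((real m + 1)\<^sup>2 / ((2 * real m + 1) * (2 * real m + 3)) + (real m)\<^sup>2 / ((2 * real m + 1) * (2 * real m - 1)))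
       * poly (legendre_poly m) x +
     real m * (real m - 1) / ((2 * real m + 1) * (2 * real m - 1)) * poly (legendre_poly (m - 2)) x"
proof -
  define P where "P i = poly (legendre_poly i) x" for i
  have X: "x * P i = ((real i + 1) * P (i + 1) + real i * P (i - 1)) / (2 * real i + 1)" for i
    using poly_legendre_bonnet[of i x] by (simp add: P_def field_simps)
  have up: "x * P (m + 1) = ((real m + 2) * P (m + 2) + (real m + 1) * P m) / (2 * real m + 3)"
    using X[of "m + 1"] by (simp add: algebra_simps numeral_2_eq_2)
  \<comment> \<open>The factor \<open>real m\<close> covers \<open>m = 0\<close>, where
    \<open>m - 1\<close> is truncated. For \<open>m = 1\<close> the truncated index
    \<open>m - 2\<close> has coefficient \<open>real m - 1 = 0\<close>.\<close>
  have down: "real m * (x * P (m - 1)) =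
      real m * ((real m * P m + (real m - 1) * P (m - 2)) / (2 * real m - 1))"
  proof (cases m)
    case (Suc j)
    then show ?thesis using X[of j] by (cases j) (simp_all add: algebra_simps)
  qed simp
  have "x\<^sup>2 * P m = x * (x * P m)" by (simp add: power2_eq_square)
  also have "\<dots> = ((real m + 1) * (x * P (m + 1)) + real m * (x * P (m - 1))) / (2 * real m + 1)"
    unfolding X[of m] by (simp add: algebra_simps)
  also have "\<dots> = (real m + 1) / (2 * real m + 1) * (((real m + 2) * P (m + 2) + (real m + 1) * P m) / (2 * real m + 3))
      + 1 / (2 * real m + 1) * (real m * ((real m * P m + (real m - 1) * P (m - 2)) / (2 * real m - 1)))"
  proof -
    have "(a * u + v) / d = a / d * u + 1 / d * v" for a u v d :: real
      by (simp add: add_divide_distrib)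
    then show ?thesis unfolding up down .
  qed
  also have "\<dots> = (real m + 1) * (real m + 2) / ((2 * real m + 1) * (2 * real m + 3)) * P (m + 2) +
     ((real m + 1)\<^sup>2 / ((2 * real m + 1) * (2 * real m + 3)) + (real m)\<^sup>2 / ((2 * real m + 1) * (2 * real m - 1)))
       * P m +
     real m * (real m - 1) / ((2 * real m + 1) * (2 * real m - 1)) * P (m - 2)"
  proof -
    have "a / d * ((b * u + a * v) / e) + 1 / d * (n * ((n * v + k * w) / g)) =
        a * b / (d * e) * u + (a\<^sup>2 / (d * e) + n\<^sup>2 / (d * g)) * v + n * k / (d * g) * w"
      for a b d e g k n u v w :: real
      by (simp add: add_divide_distrib power2_eq_square algebra_simps)
    then show ?thesis .
  qed
  finally show ?thesis unfolding P_def .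
qed

text \<open>Differentiating the recurrence with the antiderivative turns the latter into a Legendre
  polynomial, which merges with the term from the product rule.\<close>

lemma pderiv_legendre_Suc:
  "pderiv (legendre_poly (Suc k)) =
     [:0, 1:] * pderiv (legendre_poly k) + smult (real (Suc k)) (legendre_poly k)"
proof (cases k)
  case (Suc j)
  have "pderiv [:0, 1::real:] = 1" by (simp add: pderiv_pCons)
  moreover have "real (Suc (Suc j)) = 1 + real (Suc j)" by simp
  ultimately show ?thesis unfolding Suc
    by (simp only: legendre_Suc_Suc_eq_antideriv[of j] pderiv_add pderiv_mult pderiv_smult
        pderiv_legendre_antideriv smult_add_left smult_1_left mult_1_right add.assoc)
qed (simp add: pderiv_pCons)

lemma pderiv_legendre_Suc_Suc_diff:
  "pderiv (legendre_poly (Suc (Suc k))) =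
     smult (real (2 * k + 3)) (legendre_poly (Suc k)) + pderiv (legendre_poly k)"
  by (simp only: legendre_Suc_Suc_diff pderiv_add pderiv_smult pderiv_legendre_antideriv)

text \<open>The derivative relations express \<open>(1 - x\<^sup>2) * P'\<close> through two
  Legendre polynomials without derivatives. Differentiating that expression and using
  \<open>down\<close> once more gives the equation.\<close>

lemma legendre_ode:
  "((\<lambda>x. (1 - x\<^sup>2) * poly (pderiv (legendre_poly k)) x) has_real_derivative
     - (real k * (real k + 1)) * poly (legendre_poly k) x) (at x within S)"
proof (cases k)
  case 0
  then show ?thesis by (simp add: pderiv_1)
next
  case (Suc j)
  define P where "P i y = poly (legendre_poly i) y" for i y
  define P' where "P' i y = poly (pderiv (legendre_poly i)) y" for i y
  have up: "P' (Suc i) y = y * P' i y + (real i + 1) * P i y" for i y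
    by (simp add: P'_def P_def pderiv_legendre_Suc)
  \<comment> \<open>Two expressions for the derivative of P_(j+2) are equated: \<open>up\<close> at
    \<open>Suc j\<close> and the difference formula.\<close>
  have down: "P' j y = y * P' (Suc j) y - (real j + 1) * P (Suc j) y" for y
    using up[of "Suc j" y]
    by (simp add: P'_def P_def pderiv_legendre_Suc_Suc_diff[of j] algebra_simps)
  have eq: "(1 - y\<^sup>2) * P' (Suc j) y = (real j + 1) * (P j y - y * P (Suc j) y)" for y
    using up[of j y] down[of y] by algebra
  have "((\<lambda>y. (real j + 1) * (P j y - y * P (Suc j) y)) has_real_derivative
      (real j + 1) * (P' j x - (P (Suc j) x + x * P' (Suc j) x))) (at x within S)"
    unfolding P_def P'_def by (auto intro!: derivative_eq_intros poly_DERIV DERIV_subset[OF poly_DERIV])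
  moreover have "(real j + 1) * (P' j x - (P (Suc j) x + x * P' (Suc j) x)) =
      - (real (Suc j) * (real (Suc j) + 1)) * P (Suc j) x"
    unfolding down by (simp add: algebra_simps)
  ultimately show ?thesis unfolding Suc P_def[symmetric] P'_def[symmetric] eq by simp
qed


section \<open>Eigenfunctions of the Sturm-Liouville operator\<close>

lemma Dseg_eqI:
  assumes "x \<in> {-1..1}" "(f has_real_derivative d) (at x within {-1..1})"
  shows "Dseg f x = d"
  unfolding Dseg_def
  using assms vector_derivative_within_cbox[of "-1" 1 x f d]
  by (simp add: has_real_derivative_iff_has_vector_derivative)

lemma smooth_seg_has_derivative:
  assumes "smooth_seg f" "x \<in> {-1..1}"
  shows "((Dseg ^^ j) f has_real_derivative (Dseg ^^ Suc j) f x) (at x within {-1..1})"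
proof -
  have "(Dseg ^^ j) f differentiable (at x within {-1..1})"
    using assms unfolding smooth_seg_def differentiable_on_def by blast
  then show ?thesis
    by (simp add: Dseg_def vector_derivative_works has_real_derivative_iff_has_vector_derivative)
qed

lemma sl_eigenfunction_has_derivative:
  assumes "sl_eigenfunction c l f" "x \<in> {-1..1}"
  shows "(f has_real_derivative Dseg f x) (at x within {-1..1})"
  using smooth_seg_has_derivative[of f x 0] assms by (simp add: sl_eigenfunction_def)

text \<open>\<open>Dseg\<close> is a choice operator, so the eigenvalue equation alone does not make
  the flux differentiable. Smoothness and the product rule do, and the equation then identifies the
  value.\<close>

lemma sl_eigenfunction_flux_has_derivative:
  assumes "sl_eigenfunction c l f" "x \<in> {-1..1}"
  shows "((\<lambda>t. (1 - t\<^sup>2) * Dseg f t) has_real_derivative (c\<^sup>2 * x\<^sup>2 - l) * f x) (at x within {-1..1})"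
proof -
  have "(Dseg f has_real_derivative Dseg (Dseg f) x) (at x within {-1..1})"
    using smooth_seg_has_derivative[of f x 1] assms by (simp add: sl_eigenfunction_def)
  then have *: "((\<lambda>t. (1 - t\<^sup>2) * Dseg f t) has_real_derivative
      (- 2 * x * Dseg f x + (1 - x\<^sup>2) * Dseg (Dseg f) x)) (at x within {-1..1})"
    by (auto intro!: derivative_eq_intros)
  then have "Dseg (\<lambda>t. (1 - t\<^sup>2) * Dseg f t) x = - 2 * x * Dseg f x + (1 - x\<^sup>2) * Dseg (Dseg f) x"
    by (rule Dseg_eqI[OF assms(2)])
  moreover have "sturm_liouville c f x = l * f x"
    using assms by (simp add: sl_eigenfunction_def)
  ultimately have "- 2 * x * Dseg f x + (1 - x\<^sup>2) * Dseg (Dseg f) x = (c\<^sup>2 * x\<^sup>2 - l) * f x"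
    unfolding sturm_liouville_def by (simp add: algebra_simps)
  with * show ?thesis by simp
qed

lemma sl_eigenfunction_continuous:
  assumes "sl_eigenfunction c l f"
  shows "continuous_on {-1..1} f"
  using sl_eigenfunction_has_derivative[OF assms]
  by (metis continuous_on_eq_continuous_within DERIV_continuous)

text \<open>Left unnormalized, so that the recurrence has the very coefficients of x^2 P_m, whose
  sum is 1.\<close>

definition legendre_integral :: "(real \<Rightarrow> real) \<Rightarrow> nat \<Rightarrow> real" where
  "legendre_integral f k = integral {-1..1} (\<lambda>x. f x * poly (legendre_poly k) x)"

lemma legendre_coeff_eq: "legendre_coeff f k = sqrt (real k + 1/2) * legendre_integral f k"
  unfolding legendre_coeff_def legendre_normalized_def legendre_integral_def
  by (subst integral_mult_right[symmetric]) (simp add: mult_ac)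

lemma legendre_integrable:
  assumes "continuous_on {-1..1} f"
  shows "(\<lambda>x. f x * poly (legendre_poly k) x) integrable_on {-1..1}"
  by (intro integrable_continuous_real continuous_intros assms)

text \<open>Lagrange's identity: the integrand is the derivative of the Wronskian-like expression (1
  - x^2) (f' P - f P'), which vanishes at both endpoints.\<close>

lemma sl_eigenfunction_legendre:
  assumes "sl_eigenfunction c l f"
  shows "((\<lambda>x. (c\<^sup>2 * x\<^sup>2 - l + real k * (real k + 1)) * (f x * poly (legendre_poly k) x)) has_integral 0) {-1..1}"
proof -
  let ?P = "poly (legendre_poly k)" and ?P' = "poly (pderiv (legendre_poly k))"
  define \<Phi> where "\<Phi> x = ((1 - x\<^sup>2) * Dseg f x) * ?P x - f x * ((1 - x\<^sup>2) * ?P' x)" for x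
  have "(\<Phi> has_vector_derivative
       (c\<^sup>2 * x\<^sup>2 - l + real k * (real k + 1)) * (f x * ?P x)) (at x within {-1..1})"
    if x: "x \<in> {-1..1}" for x
  proof -
    have "(\<Phi> has_real_derivative
       ((c\<^sup>2 * x\<^sup>2 - l) * f x) * ?P x + ?P' x * ((1 - x\<^sup>2) * Dseg f x) -
       (Dseg f x * ((1 - x\<^sup>2) * ?P' x) + (- (real k * (real k + 1)) * ?P x) * f x)) (at x within {-1..1})"
      unfolding \<Phi>_def
      by (intro DERIV_diff DERIV_mult sl_eigenfunction_flux_has_derivative[OF assms x]
          sl_eigenfunction_has_derivative[OF assms x] legendre_ode DERIV_subset[OF poly_DERIV]) simp
    then show ?thesis
      by (simp add: has_real_derivative_iff_has_vector_derivative[symmetric] algebra_simps)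
  qed
  from fundamental_theorem_of_calculus[OF _ this]
  have "((\<lambda>x. (c\<^sup>2 * x\<^sup>2 - l + real k * (real k + 1)) * (f x * ?P x)) has_integral (\<Phi> 1 - \<Phi> (-1))) {-1..1}"
    by simp
  then show ?thesis by (simp add: \<Phi>_def)
qed

lemma legendre_integral_recurrence:
  assumes "sl_eigenfunction c l f"
  shows "(l - real m * (real m + 1)) * legendre_integral f m = c\<^sup>2 * (
      (real m + 1) * (real m + 2) / ((2 * real m + 1) * (2 * real m + 3)) * legendre_integral f (m + 2) +
      ((real m + 1)\<^sup>2 / ((2 * real m + 1) * (2 * real m + 3)) + (real m)\<^sup>2 / ((2 * real m + 1) * (2 * real m - 1)))
       * legendre_integral f m +
      real m * (real m - 1) / ((2 * real m + 1) * (2 * real m - 1)) * legendre_integral f (m - 2))"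
    (is "_ = c\<^sup>2 * (?A * _ + ?B * _ + ?C * _)")
proof -
  let ?F = "\<lambda>k x. f x * poly (legendre_poly k) x"
  let ?I = "legendre_integral f"
  have I: "(?F k has_integral ?I k) {-1..1}" for k
    unfolding legendre_integral_def
    by (intro integrable_integral legendre_integrable sl_eigenfunction_continuous[OF assms])
  have "((\<lambda>x. c\<^sup>2 * (?A * ?F (m + 2) x + ?B * ?F m x + ?C * ?F (m - 2) x)
         + (real m * (real m + 1) - l) * ?F m x) has_integral
       c\<^sup>2 * (?A * ?I (m + 2) + ?B * ?I m + ?C * ?I (m - 2)) + (real m * (real m + 1) - l) * ?I m) {-1..1}"
    by (intro has_integral_add has_integral_mult_right I)
  moreover have "c\<^sup>2 * (?A * ?F (m + 2) x + ?B * ?F m x + ?C * ?F (m - 2) x)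
         + (real m * (real m + 1) - l) * ?F m x =
        (c\<^sup>2 * x\<^sup>2 - l + real m * (real m + 1)) * ?F m x" for x
  proof -
    have "c\<^sup>2 * (?A * ?F (m + 2) x + ?B * ?F m x + ?C * ?F (m - 2) x) =
        c\<^sup>2 * f x * (?A * poly (legendre_poly (m + 2)) x + ?B * poly (legendre_poly m) x
           + ?C * poly (legendre_poly (m - 2)) x)"
      by (simp only: algebra_simps)
    then show ?thesis unfolding poly_X_sq_legendre[symmetric] by (simp add: algebra_simps)
  qed
  ultimately have "c\<^sup>2 * (?A * ?I (m + 2) + ?B * ?I m + ?C * ?I (m - 2)) + (real m * (real m + 1) - l) * ?I m = 0"
    using has_integral_unique[OF _ sl_eigenfunction_legendre[OF assms, of m]] by simp
  then show ?thesis by (simp add: algebra_simps)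
qed

section \<open>Growth of the coefficients\<close>

text \<open>The witness \<open>s\<close> is a common sign of both integrals and also serves when
  they vanish. Sign and monotonicity are part of the induction because they control the term in
  \<open>m - 2\<close>: it is at most its value with \<open>m\<close> for the lower bound, and
  nonnegative for the upper bound.\<close>

lemma legendre_integral_growth:
  assumes "sl_eigenfunction c l f" "c > 0" "real m * (real m + 1) + c\<^sup>2 \<le> l"
  shows "\<exists>s\<in>{-1, 1}. 0 \<le> s * legendre_integral f m \<and>
     s * legendre_integral f m \<le> s * legendre_integral f (m + 2) \<and>
     c\<^sup>2 * ((real m + 1) * (real m + 2) / ((2 * real m + 1) * (2 * real m + 3)))
       * (s * legendre_integral f (m + 2)) \<le> l * (s * legendre_integral f m)"
  using assms(3)
proof (induction m rule: nat_less_induct)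
  case (1 m)
  let ?I = "legendre_integral f"
  define A B C where "A = (real m + 1) * (real m + 2) / ((2 * real m + 1) * (2 * real m + 3))"
    and "B = (real m + 1)\<^sup>2 / ((2 * real m + 1) * (2 * real m + 3)) + (real m)\<^sup>2 / ((2 * real m + 1) * (2 * real m - 1))"
    and "C = real m * (real m - 1) / ((2 * real m + 1) * (2 * real m - 1))"
  have sum1: "A + B + C = 1"
  proof (cases m)
    case (Suc j)
    have "(2 * real m + 1) * (2 * real m - 1) * (2 * real m + 3) \<noteq> 0" unfolding Suc by (simp add: add_eq_0_iff)
    then show ?thesis unfolding A_def B_def C_def
      by (simp add: divide_simps power2_eq_square) algebra
  qed (simp add: A_def B_def C_def)
  have "A > 0" unfolding A_def by (intro divide_pos_pos mult_pos_pos) auto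
  have "B \<ge> 0" unfolding B_def by (cases m) (auto intro!: add_nonneg_nonneg divide_nonneg_nonneg mult_nonneg_nonneg)
  have "C \<ge> 0" unfolding C_def by (cases m) (auto intro!: divide_nonneg_nonneg mult_nonneg_nonneg)
  \<comment> \<open>The factor \<open>C\<close> makes the claim uniform: it is 0 for
    \<open>m < 2\<close>, where \<open>m - 2\<close> is truncated and \<open>s\<close> only has to
    fit \<open>?I m\<close>. Otherwise the induction hypothesis at \<open>m - 2\<close>
    applies.\<close>
  have "\<exists>s\<in>{-1, 1}. 0 \<le> s * ?I m \<and> 0 \<le> C * (s * ?I (m - 2)) \<and> C * (s * ?I (m - 2)) \<le> C * (s * ?I m)"
  proof (cases "m < 2")
    case True
    then have "m = 0 \<or> m = 1" by auto
    then have "C = 0" unfolding C_def by auto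
    then show ?thesis by (cases "?I m \<ge> 0") auto
  next
    case False
    then have m: "m - 2 < m" "m - 2 + 2 = m" by auto
    have "real (m - 2) * (real (m - 2) + 1) \<le> real m * (real m + 1)"
      by (intro mult_mono) auto
    then have "real (m - 2) * (real (m - 2) + 1) + c\<^sup>2 \<le> l" using 1(2) by linarith
    then obtain s where "s \<in> {-1, 1}" "0 \<le> s * ?I (m - 2)" "s * ?I (m - 2) \<le> s * ?I m"
      using 1(1)[rule_format, OF m(1)] unfolding m(2) by blast
    then show ?thesis using \<open>C \<ge> 0\<close> by (intro bexI[of _ s]) (auto intro: mult_left_mono)
  qed
  then obtain s where s: "s \<in> {-1, 1}" "0 \<le> s * ?I m"
    and C: "0 \<le> C * (s * ?I (m - 2))" "C * (s * ?I (m - 2)) \<le> C * (s * ?I m)" by blast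
  define y where "y = s * ?I m"
  have "(l - real m * (real m + 1)) * ?I m = c\<^sup>2 * (A * ?I (m + 2) + B * ?I m + C * ?I (m - 2))"
    unfolding A_def B_def C_def by (rule legendre_integral_recurrence[OF assms(1)])
  then have rec: "(l - real m * (real m + 1)) * y = c\<^sup>2 * (A * (s * ?I (m + 2)) + B * y + C * (s * ?I (m - 2)))"
    unfolding y_def by algebra
  have "c\<^sup>2 * y \<le> (l - real m * (real m + 1)) * y"
    using 1(2) s(2) unfolding y_def by (intro mult_right_mono) auto
  then have "c\<^sup>2 * y \<le> c\<^sup>2 * (A * (s * ?I (m + 2)) + B * y + C * (s * ?I (m - 2)))"
    unfolding rec .
  then have "y \<le> A * (s * ?I (m + 2)) + B * y + C * (s * ?I (m - 2))"
    using assms(2) by simp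
  \<comment> \<open>A weighted mean of three values is at least \<open>y\<close>. The
    \<open>B\<close> value equals \<open>y\<close> and the \<open>C\<close> value contributes at
    most \<open>C * y\<close>, so the \<open>A\<close> value cannot be below
    \<open>y\<close>.\<close>
  then have "(A + B + C) * y \<le> A * (s * ?I (m + 2)) + B * y + C * y"
    using C(2) unfolding sum1 y_def by linarith
  then have "A * y \<le> A * (s * ?I (m + 2))" by (simp add: algebra_simps)
  then have "y \<le> s * ?I (m + 2)" using \<open>A > 0\<close> by simp
  moreover have "c\<^sup>2 * A * (s * ?I (m + 2)) \<le> l * y"
  proof -
    have "0 \<le> c\<^sup>2 * (B * y + C * (s * ?I (m - 2)))"
      using \<open>B \<ge> 0\<close> C(1) s(2) unfolding y_def
      by (intro mult_nonneg_nonneg[OF zero_le_power2] add_nonneg_nonneg mult_nonneg_nonneg[of B])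
    moreover have "0 \<le> real m * (real m + 1) * y" using s(2) unfolding y_def by simp
    ultimately show ?thesis using rec by (simp add: algebra_simps)
  qed
  ultimately show ?case using s unfolding y_def A_def by blast
qed

lemma abs_legendre_integral_growth:
  assumes "sl_eigenfunction c l f" "c > 0" "real m * (real m + 1) + c\<^sup>2 \<le> l"
  shows "c\<^sup>2 * ((real m + 1) * (real m + 2) / ((2 * real m + 1) * (2 * real m + 3)))
       * \<bar>legendre_integral f (m + 2)\<bar> \<le> l * \<bar>legendre_integral f m\<bar>"
proof -
  obtain s where "s \<in> {-1, 1}" and *: "0 \<le> s * legendre_integral f m"
     "s * legendre_integral f m \<le> s * legendre_integral f (m + 2)"
     "c\<^sup>2 * ((real m + 1) * (real m + 2) / ((2 * real m + 1) * (2 * real m + 3)))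
       * (s * legendre_integral f (m + 2)) \<le> l * (s * legendre_integral f m)"
    using legendre_integral_growth[OF assms] by blast
  then have "\<bar>s\<bar> = 1" by auto
  then have "s * legendre_integral f m = \<bar>legendre_integral f m\<bar>"
    "s * legendre_integral f (m + 2) = \<bar>legendre_integral f (m + 2)\<bar>"
    using abs_of_nonneg[OF *(1)] abs_of_nonneg[of "s * legendre_integral f (m + 2)"] *(1,2)
    by (simp_all add: abs_mult)
  with *(3) show ?thesis by simp
qed

text \<open>The factor \<open>D / N\<close> of the unnormalized integrals stays below 4, by enough
  to absorb the ratio of the normalizing constants sqrt (m + 5/2) and sqrt (m + 1/2).\<close>

lemma legendre_coeff_growth:
  assumes "sl_eigenfunction c l f" "c > 0" "real m * (real m + 1) + c\<^sup>2 \<le> l"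
  shows "\<bar>legendre_coeff f (m + 2)\<bar> \<le> 4 * l / c\<^sup>2 * \<bar>legendre_coeff f m\<bar>"
proof -
  define N D where "N = (real m + 1) * (real m + 2)" and "D = (2 * real m + 1) * (2 * real m + 3)"
  have pos: "N > 0" "D > 0" unfolding N_def D_def by (intro mult_pos_pos; simp)+
  have "(real m + 5/2) * D\<^sup>2 \<le> (real m + 1/2) * (4 * N)\<^sup>2"
  proof -
    \<comment> \<open>The midpoint of the factors 2m+1, ..., 2m+5, which become t-2, ..., t+2. After
      cancelling (t - 2) / 2 the claim is (t^2 - 4) t^2 \<le> (t^2 - 1)^2.\<close>
    define t where "t = 2 * real m + 3"
    have "t \<ge> 1" unfolding t_def by simp
    have "(t + 2) * (t - 2) * t\<^sup>2 \<le> (t\<^sup>2 - 1)\<^sup>2"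
      using \<open>t \<ge> 1\<close> by (simp add: power2_eq_square algebra_simps)
    then have "(t - 2) / 2 * ((t + 2) * (t - 2) * t\<^sup>2) \<le> (t - 2) / 2 * (t\<^sup>2 - 1)\<^sup>2"
      by (rule mult_left_mono) (simp add: t_def)
    moreover have "(real m + 5/2) * D\<^sup>2 = (t - 2) / 2 * ((t + 2) * (t - 2) * t\<^sup>2)"
      unfolding D_def t_def by (simp add: power2_eq_square field_simps)
    moreover have "(real m + 1/2) * (4 * N)\<^sup>2 = (t - 2) / 2 * (t\<^sup>2 - 1)\<^sup>2"
      unfolding N_def t_def by (simp add: power2_eq_square field_simps)
    ultimately show ?thesis by simp
  qed
  then have "sqrt ((real m + 5/2) * D\<^sup>2) \<le> sqrt ((real m + 1/2) * (4 * N)\<^sup>2)" by simp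
  then have R: "sqrt (real m + 5/2) * D \<le> sqrt (real m + 1/2) * (4 * N)"
    using pos by (simp add: real_sqrt_mult)
  let ?I = "legendre_integral f"
  have "c\<^sup>2 * (N / D) * \<bar>?I (m + 2)\<bar> \<le> l * \<bar>?I m\<bar>"
    unfolding N_def D_def by (rule abs_legendre_integral_growth[OF assms])
  then have I: "\<bar>?I (m + 2)\<bar> \<le> D / N * (l / c\<^sup>2 * \<bar>?I m\<bar>)"
    using pos assms(2) by (simp add: field_simps)
  have "l \<ge> 0" using assms(3) by (smt (verit) mult_nonneg_nonneg of_nat_0_le_iff zero_le_power2)
  have "\<bar>legendre_coeff f (m + 2)\<bar> = sqrt (real m + 5/2) * \<bar>?I (m + 2)\<bar>"
    by (simp add: legendre_coeff_eq abs_mult)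
  also have "\<dots> \<le> sqrt (real m + 5/2) * (D / N * (l / c\<^sup>2 * \<bar>?I m\<bar>))"
    using I by (intro mult_left_mono) auto
  also have "\<dots> = (sqrt (real m + 5/2) * D) * (l / c\<^sup>2 * \<bar>?I m\<bar> / N)"
    by (simp add: mult_ac)
  also have "\<dots> \<le> (sqrt (real m + 1/2) * (4 * N)) * (l / c\<^sup>2 * \<bar>?I m\<bar> / N)"
    using R pos \<open>l \<ge> 0\<close> by (intro mult_right_mono) auto
  also have "\<dots> = 4 * l / c\<^sup>2 * \<bar>legendre_coeff f m\<bar>"
    using pos by (simp add: legendre_coeff_eq abs_mult)
  finally show ?thesis .
qed

section \<open>Values at the origin\<close>

text \<open>With y = |x| the claim y (1 + q - 2 q y^2) \<le> 1 is affine in \<open>q\<close>, so it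
  interpolates between y \<le> 1 at q = 0 and 2 y - 2 y^3 \<le> 1 at q = 1.\<close>

lemma energy_slope_bound:
  assumes "\<bar>x\<bar> \<le> 1" "0 \<le> q" "q \<le> (1::real)"
  shows "\<bar>2 * x * (1 + q - 2 * q * x\<^sup>2)\<bar> \<le> 2"
proof -
  define y where "y = \<bar>x\<bar>"
  have y: "0 \<le> y" "y \<le> 1" using assms unfolding y_def by auto
  have "y\<^sup>2 \<le> 1" using y by (simp add: power_le_one)
  then have "q * y\<^sup>2 \<le> q" using assms by (simp add: mult_left_le)
  then have nn: "0 \<le> 1 + q - 2 * q * y\<^sup>2" using assms by simp
  have "0 \<le> (y - 3/5)\<^sup>2 * (y + 6/5)" using y by simp
  \<comment> \<open>the tangent of \<open>y\<^sup>3\<close> near the minimum \<open>1 / sqrt 3\<close> of \<open>1 - 2 y + 2 y\<^sup>3\<close>\<close>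
  moreover have "(y - 3/5)\<^sup>2 * (y + 6/5) = y ^ 3 - 27/25 * y + 54/125"
    by (simp add: power2_eq_square power3_eq_cube field_simps)
  ultimately have "0 \<le> 1 - 2 * y + 2 * y ^ 3" using y(1) by linarith
  then have "0 \<le> (1 - q) * (1 - y) + q * (1 - 2 * y + 2 * y ^ 3)"
    using assms y by (intro add_nonneg_nonneg[of "(1 - q) * (1 - y)"] mult_nonneg_nonneg[of "1 - q"] mult_nonneg_nonneg[of q]) auto
  then have "y * (1 + q - 2 * q * y\<^sup>2) \<le> 1"
    by (simp add: power2_eq_square power3_eq_cube algebra_simps)
  moreover have "\<bar>2 * x * (1 + q - 2 * q * x\<^sup>2)\<bar> = 2 * (y * (1 + q - 2 * q * y\<^sup>2))"
    using nn by (simp add: abs_mult y_def)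
  ultimately show ?thesis by simp
qed

lemma sl_eigenfunction_origin:
  assumes f: "sl_eigenfunction c l f" and l: "l > 0" "c\<^sup>2 \<le> l"
    and norm: "integral {-1..1} (\<lambda>x. \<bar>f x\<bar>\<^sup>2) = 1"
  shows "(f 0)\<^sup>2 + (Dseg f 0)\<^sup>2 / l \<le> 1"
proof -
  define q where "q = c\<^sup>2 / l"
  have q: "0 \<le> q" "q \<le> 1" using l unfolding q_def by auto
  define g where "g x = (1 - x\<^sup>2) * Dseg f x" for x
  \<comment> \<open>Since g' = -l (1 - q x^2) f, the derivative of g^2 / l is -(1 - x^2) (1 - q x^2)
    (f^2)'. The weight of f^2 is chosen to cancel it, and only the derivative of the weight
    remains.\<close>
  define E where "E x = (1 - x\<^sup>2) * (1 - q * x\<^sup>2) * (f x)\<^sup>2 + (g x)\<^sup>2 / l" for x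
  define e where "e x = - (2 * x * (1 + q - 2 * q * x\<^sup>2)) * (f x)\<^sup>2" for x
  have E': "(E has_real_derivative e x) (at x within {-1..1})" if x: "x \<in> {-1..1}" for x
  proof -
    have g': "(g has_real_derivative (c\<^sup>2 * x\<^sup>2 - l) * f x) (at x within {-1..1})"
      using sl_eigenfunction_flux_has_derivative[OF f x] unfolding g_def .
    have "(E has_real_derivative
        ((- (2 * x)) * (1 - q * x\<^sup>2) + (- (q * (2 * x))) * (1 - x\<^sup>2)) * (f x)\<^sup>2
         + (2 * (f x * Dseg f x)) * ((1 - x\<^sup>2) * (1 - q * x\<^sup>2))
         + 2 * (g x * ((c\<^sup>2 * x\<^sup>2 - l) * f x)) / l) (at x within {-1..1})"
      unfolding E_def
      using l by (auto intro!: derivative_eq_intros g' sl_eigenfunction_has_derivative[OF f x] simp: mult_ac)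
    moreover have g: "2 * (g x * ((c\<^sup>2 * x\<^sup>2 - l) * f x)) / l = - 2 * (g x * ((1 - q * x\<^sup>2) * f x))"
      using l unfolding q_def by (simp add: field_simps)
    moreover have "((- (2 * x)) * (1 - q * x\<^sup>2) + (- (q * (2 * x))) * (1 - x\<^sup>2)) * (f x)\<^sup>2
         + (2 * (f x * Dseg f x)) * ((1 - x\<^sup>2) * (1 - q * x\<^sup>2))
         + 2 * (g x * ((c\<^sup>2 * x\<^sup>2 - l) * f x)) / l = e x"
      unfolding g unfolding e_def g_def by (simp add: power2_eq_square algebra_simps)
    ultimately show ?thesis by simp
  qed
  have cont: "continuous_on {-1..1} f" by (rule sl_eigenfunction_continuous[OF f])
  have sq: "(\<lambda>x. (f x)\<^sup>2) integrable_on {a..b}" if "-1 \<le> a" "b \<le> 1" for a b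
    by (rule integrable_continuous_real) (intro continuous_intros continuous_on_subset[OF cont], use that in auto)
  have half: "\<bar>E b - E a\<bar> \<le> 2 * integral {a..b} (\<lambda>x. (f x)\<^sup>2)" if ab: "-1 \<le> a" "a \<le> b" "b \<le> 1" for a b
  proof -
    have "(e has_integral (E b - E a)) {a..b}"
    proof (rule fundamental_theorem_of_calculus[OF ab(2)])
      show "(E has_vector_derivative e x) (at x within {a..b})" if "x \<in> {a..b}" for x
        using DERIV_subset[OF E', of x "{a..b}"] ab that
        by (simp add: has_real_derivative_iff_has_vector_derivative[symmetric])
    qed
    moreover have "\<bar>e x\<bar> \<le> 2 * (f x)\<^sup>2" if "x \<in> {a..b}" for x
    proof -
      have "\<bar>2 * x * (1 + q - 2 * q * x\<^sup>2)\<bar> \<le> 2"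
        by (rule energy_slope_bound) (use ab that q in auto)
      then have "\<bar>2 * x * (1 + q - 2 * q * x\<^sup>2)\<bar> * (f x)\<^sup>2 \<le> 2 * (f x)\<^sup>2"
        by (rule mult_right_mono) simp
      then show ?thesis unfolding e_def by (simp add: abs_mult)
    qed
    moreover have "(\<lambda>x. 2 * (f x)\<^sup>2) integrable_on {a..b}" using sq[OF ab(1,3)] by simp
    ultimately have "norm (integral {a..b} e) \<le> integral {a..b} (\<lambda>x. 2 * (f x)\<^sup>2)"
      by (intro integral_norm_bound_integral) auto
    then show ?thesis
      using \<open>(e has_integral (E b - E a)) {a..b}\<close> by (simp add: integral_unique)
  qed
  \<comment> \<open>\<open>E 0\<close> is at most twice the integral of f^2 over either half of the
    interval; adding the two bounds gives 2 E(0) \<le> 2.\<close>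
  have "E 1 = 0" "E (-1) = 0" "E 0 = (f 0)\<^sup>2 + (Dseg f 0)\<^sup>2 / l" by (simp_all add: E_def g_def)
  moreover have "integral {-1..0} (\<lambda>x. (f x)\<^sup>2) + integral {0..1} (\<lambda>x. (f x)\<^sup>2) = 1"
    using Henstock_Kurzweil_Integration.integral_combine[of "-1" 0 1 "\<lambda>x. (f x)\<^sup>2"] sq[of "-1" 1] norm
    by simp
  ultimately show ?thesis using half[of "-1" 0] half[of 0 1] by simp
qed

section \<open>The finite Fourier transform at the origin\<close>

lemma finite_fourier_zero:
  assumes "continuous_on {-1..1} f"
  shows "finite_fourier c (\<lambda>y. of_real (f y)) 0 = of_real (integral {-1..1} f)"
proof -
  have "(f has_integral integral {-1..1} f) {-1..1}"
    by (intro integrable_integral integrable_continuous_real assms)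
  from integral_unique[OF has_integral_of_real[OF this]] show ?thesis
    by (simp add: finite_fourier_def)
qed

text \<open>Differentiation under the integral sign. The derivative is taken within [-1,1] to match
  the domain on which the eigenvalue equation is given.\<close>

lemma finite_fourier_has_derivative_zero:
  assumes "continuous_on {-1..1} f"
  shows "(finite_fourier c (\<lambda>y. of_real (f y)) has_vector_derivative
     \<i> * of_real c * of_real (integral {-1..1} (\<lambda>y. f y * y))) (at 0 within {-1..1})"
proof -
  let ?f = "\<lambda>x y. exp (\<i> * of_real (c * x * y)) * of_real (f y) :: complex"
  let ?f' = "\<lambda>x y. exp (\<i> * of_real (c * x * y)) * (\<i> * of_real (c * y)) * of_real (f y) :: complex"
  have D: "((\<lambda>x. integral (cbox (-1) 1) (?f x)) has_vector_derivative integral (cbox (-1) 1) (?f' 0))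
      (at 0 within {-1..1})"
  proof (rule leibniz_rule_vector_derivative)
    show "((\<lambda>x. ?f x t) has_vector_derivative ?f' x t) (at x within {-1..1})" for x t
    proof -
      have "((\<lambda>z. exp (\<i> * (of_real c * z * of_real t)) * of_real (f t)) has_field_derivative ?f' x t)
          (at (of_real x) within of_real ` {-1..1})"
        by (auto intro!: derivative_eq_intros)
      from field_vector_diff_chain_within[OF has_vector_derivative_of_real[OF DERIV_ident] this]
      show ?thesis by (simp add: o_def)
    qed
    show "?f x integrable_on cbox (-1) 1" for x
      unfolding cbox_interval
      by (intro integrable_continuous_real continuous_intros assms)
    have "continuous_on ({-1..1} \<times> {-1..1}) (\<lambda>z :: real \<times> real. f (snd z))"
      by (rule continuous_on_compose2[OF assms continuous_on_snd]) auto
    then show "continuous_on ({-1..1} \<times> cbox (-1) 1) (\<lambda>(x, t). ?f' x t)"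
      unfolding cbox_interval split_beta by (intro continuous_intros)
  qed auto
  have "integral {-1..1} (?f' 0) = integral {-1..1} (\<lambda>y. \<i> * of_real c * of_real (f y * y))"
    by (simp add: mult_ac)
  also have "\<dots> = \<i> * of_real c * of_real (integral {-1..1} (\<lambda>y. f y * y))"
  proof -
    have "((\<lambda>y. f y * y) has_integral integral {-1..1} (\<lambda>y. f y * y)) {-1..1}"
      by (intro integrable_integral integrable_continuous_real continuous_intros assms)
    from has_integral_mult_right[OF has_integral_of_real[OF this]] show ?thesis
      by (rule integral_unique)
  qed
  finally show ?thesis using D unfolding finite_fourier_def cbox_interval by (simp only:)
qed

text \<open>Value and derivative at 0 of the Fourier eigenvalue equation: as P_0 = 1 and P_1 = x,
  the left sides are the first two Legendre integrals, up to the factor \<i> c for the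
  second.\<close>

lemma cmod_moments:
  assumes f: "sl_eigenfunction c l f"
    and eig: "\<And>x. x \<in> {-1..1} \<Longrightarrow> finite_fourier c (\<lambda>y. of_real (f y)) x = mu * of_real (f x)"
  shows "\<bar>legendre_integral f 0\<bar> = cmod mu * \<bar>f 0\<bar>"
    and "\<bar>c\<bar> * \<bar>legendre_integral f 1\<bar> = cmod mu * \<bar>Dseg f 0\<bar>"
proof -
  have "of_real (integral {-1..1} f) = mu * of_real (f 0)"
    using eig[of 0] finite_fourier_zero[OF sl_eigenfunction_continuous[OF f], of c] by simp
  from arg_cong[OF this, of cmod] show "\<bar>legendre_integral f 0\<bar> = cmod mu * \<bar>f 0\<bar>"
    by (simp add: legendre_integral_def norm_mult)
  have "(f has_real_derivative Dseg f 0) (at 0 within {-1..1})"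
    by (rule sl_eigenfunction_has_derivative[OF f]) simp
  then have "((\<lambda>x. mu * of_real (f x)) has_vector_derivative mu * of_real (Dseg f 0)) (at 0 within {-1..1})"
    by (intro has_vector_derivative_mult_right has_vector_derivative_of_real)
  then have "(finite_fourier c (\<lambda>y. of_real (f y)) has_vector_derivative mu * of_real (Dseg f 0))
      (at 0 within {-1..1})"
    by (rule has_vector_derivative_transform[rotated 2]) (use eig in auto)
  then have "\<i> * of_real c * of_real (integral {-1..1} (\<lambda>y. f y * y)) = mu * of_real (Dseg f 0)"
    using finite_fourier_has_derivative_zero[OF sl_eigenfunction_continuous[OF f], of c]
      vector_derivative_unique_within_closed_interval[of "-1" 1 0]
    by auto
  from arg_cong[OF this, of cmod]
  show "\<bar>c\<bar> * \<bar>legendre_integral f 1\<bar> = cmod mu * \<bar>Dseg f 0\<bar>"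
    by (simp add: legendre_integral_def norm_mult)
qed

section \<open>The coefficient bounds by induction in steps of two\<close>

theorem proposition2:
  fixes c :: real and chi :: "nat \<Rightarrow> real" and psi :: "nat \<Rightarrow> real \<Rightarrow> real" and mu :: "nat \<Rightarrow> complex"
  assumes "c > 0"
    and "pswf_system c chi psi"
    and "\<And>n x. x \<in> {-1..1} \<Longrightarrow>
           finite_fourier c (\<lambda>y. of_real (psi n y)) x = mu n * of_real (psi n x)"
  shows "\<forall>n k :: nat. n > 0 \<longrightarrow> k > 0 \<longrightarrow>
           real k * (real k - 1) + 1.13 * c\<^sup>2 \<le> chi n \<longrightarrow>
           (let q = c\<^sup>2 / chi n in
              \<bar>legendre_coeff (psi n) 0\<bar> \<le> 1 / sqrt 2 * cmod (mu n) \<and>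
              \<bar>legendre_coeff (psi n) k\<bar> \<le> sqrt (5 / (4 * pi)) * (2 / sqrt q) ^ k * cmod (mu n))"
proof (intro allI impI)
  fix n k :: nat
  assume "k > 0" and k: "real k * (real k - 1) + 1.13 * c\<^sup>2 \<le> chi n"
  define f l M where "f = psi n" and "l = chi n" and "M = cmod (mu n)"
  have f: "sl_eigenfunction c l f" and norm: "integral {-1..1} (\<lambda>x. \<bar>f x\<bar>\<^sup>2) = 1"
    using assms(2) unfolding pswf_system_def f_def l_def by blast+
  have "c\<^sup>2 > 0" using assms(1) by simp
  have "real k * (real k - 1) \<ge> 0" using \<open>k > 0\<close> by simp
  moreover have k': "real k * (real k - 1) + 113 / 100 * c\<^sup>2 \<le> l" using k unfolding l_def by simp
  ultimately have l: "c\<^sup>2 \<le> l" "l > 0" using \<open>c\<^sup>2 > 0\<close> by linarith+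
  have "M \<ge> 0" unfolding M_def by simp
  have origin: "(f 0)\<^sup>2 + (Dseg f 0)\<^sup>2 / l \<le> 1"
    by (rule sl_eigenfunction_origin[OF f l(2,1) norm])
  note moments = cmod_moments[OF f assms(3)[of _ n, folded f_def], folded M_def]
  have "(f 0)\<^sup>2 \<le> 1" using origin l by (smt (verit) divide_nonneg_pos zero_le_power2)
  then have "\<bar>f 0\<bar> \<le> 1" by (simp add: abs_square_le_1)
  then have I0: "\<bar>legendre_integral f 0\<bar> \<le> M"
    using moments(1) \<open>M \<ge> 0\<close> by (simp add: mult_left_le)
  \<comment> \<open>\<open>r\<^sup>2\<close> is the factor \<open>4 * l / c\<^sup>2\<close> by which
    the coefficients grow in a step of two.\<close>
  define r where "r = 2 / sqrt (c\<^sup>2 / l)"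
  have r: "r = 2 * sqrt l / c" "r\<^sup>2 = 4 * l / c\<^sup>2" "r \<ge> 0"
    using l assms(1) by (simp_all add: r_def real_sqrt_divide power_divide power_mult_distrib)
  have "(Dseg f 0)\<^sup>2 \<le> l" using origin l by (simp add: field_simps) (smt (verit) mult_nonneg_nonneg zero_le_power2)
  then have "\<bar>Dseg f 0\<bar> \<le> sqrt l" by (metis real_sqrt_abs real_sqrt_le_iff)
  then have "c * \<bar>legendre_integral f 1\<bar> \<le> M * sqrt l"
    using moments(2) \<open>M \<ge> 0\<close> assms(1) by (simp add: mult_left_mono)
  then have I1: "\<bar>legendre_integral f 1\<bar> \<le> r / 2 * M"
    using assms(1) unfolding r by (simp add: field_simps)
  define K where "K = sqrt (5 / (4 * pi))"
  \<comment> \<open>The case of degree 1 produces the constant sqrt (3/2) / 2 = sqrt (3/8), so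
    \<open>K\<close> has to be at least that.\<close>
  have "pi \<le> 10 / 3" using pi_approx by simp
  then have "3 / 8 \<le> 5 / (4 * pi)" by (simp add: field_simps)
  then have K: "sqrt (3 / 8) \<le> K" unfolding K_def by simp
  have "\<bar>legendre_coeff f k\<bar> \<le> K * r ^ k * M"
    if "k > 0" "real k * (real k - 1) + c\<^sup>2 \<le> l" for k
    using that
  proof (induction k rule: nat_less_induct)
    case (1 k)
    \<comment> \<open>Degree 2 is a base case: the bound at degree 0 has the constant 1 / sqrt 2,
      which exceeds \<open>K\<close>. The exact coefficient 2/3 at \<open>m = 0\<close> replaces the
      cruder factor 4 there.\<close>
    consider "k = 1" | "k = 2" | m where "k = m + 2" "m > 0"
    proof -
      have "k = 1 \<or> k = 2 \<or> k = (k - 2) + 2 \<and> k - 2 > 0" using 1(2) by arith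
      then show ?thesis using that by blast
    qed
    then show ?case
    proof cases
      case 1
      have "\<bar>legendre_coeff f 1\<bar> = sqrt (3 / 2) * \<bar>legendre_integral f 1\<bar>"
        by (simp add: legendre_coeff_eq abs_mult)
      also have "\<dots> \<le> sqrt (3 / 2) * (r / 2 * M)" by (intro mult_left_mono I1) simp
      also have "\<dots> = sqrt (3 / 8) * r * M"
      proof -
        have "sqrt (3 / 2) = sqrt (2\<^sup>2 * (3 / 8))" by simp
        also have "\<dots> = 2 * sqrt (3 / 8)" by (simp only: real_sqrt_mult real_sqrt_abs abs_numeral)
        finally show ?thesis by simp
      qed
      also have "\<dots> \<le> K * r * M" using K r(3) \<open>M \<ge> 0\<close> by (intro mult_right_mono) auto
      finally show ?thesis using 1 by simp
    next
      case 2
      have "c\<^sup>2 * (2 / 3) * \<bar>legendre_integral f 2\<bar> \<le> l * \<bar>legendre_integral f 0\<bar>"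
        using abs_legendre_integral_growth[OF f assms(1), of 0] l by (simp add: numeral_2_eq_2)
      also have "\<dots> \<le> l * M" using I0 l by simp
      finally have I2: "\<bar>legendre_integral f 2\<bar> \<le> 3 / 8 * r\<^sup>2 * M"
        using \<open>c\<^sup>2 > 0\<close> unfolding r(2) by (simp add: field_simps)
      have "\<bar>legendre_coeff f 2\<bar> = sqrt (5 / 2) * \<bar>legendre_integral f 2\<bar>"
        by (simp add: legendre_coeff_eq abs_mult)
      also have "\<dots> \<le> sqrt (5 / 2) * (3 / 8 * r\<^sup>2 * M)" by (intro mult_left_mono I2) simp
      also have "\<dots> = (sqrt (5 / 2) * (3 / 8)) * r\<^sup>2 * M" by simp
      also have "\<dots> \<le> K * r\<^sup>2 * M"
      proof -
        have "sqrt (5 / 2) * (3 / 8) = sqrt (5 / 2 * (3 / 8)\<^sup>2)"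
          by (simp only: real_sqrt_mult real_sqrt_abs abs_divide abs_numeral)
        \<comment> \<open>The comparison is 45/128 \<le> 48/128.\<close>
        also have "\<dots> \<le> sqrt (3 / 8)" by (subst real_sqrt_le_iff) (simp add: power2_eq_square)
        finally show ?thesis using K \<open>M \<ge> 0\<close> by (intro mult_right_mono) auto
      qed
      finally show ?thesis using 2 by simp
    next
      case 3
      have m: "real m * (real m + 1) + c\<^sup>2 \<le> l"
        using 1(3) unfolding 3 by (simp add: algebra_simps)
      have "real m * (real m - 1) \<le> real m * (real m + 1)" by (intro mult_left_mono) auto
      then have "real m * (real m - 1) + c\<^sup>2 \<le> l" using m by linarith
      then have IH: "\<bar>legendre_coeff f m\<bar> \<le> K * r ^ m * M" using 1(1) 3 by simp
      have "\<bar>legendre_coeff f (m + 2)\<bar> \<le> r\<^sup>2 * \<bar>legendre_coeff f m\<bar>"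
        unfolding r(2) by (rule legendre_coeff_growth[OF f assms(1) m])
      also have "\<dots> \<le> r\<^sup>2 * (K * r ^ m * M)" by (intro mult_left_mono IH) simp
      also have "\<dots> = K * r ^ k * M" unfolding 3 power_add by (simp only: mult_ac)
      finally show ?thesis unfolding 3 .
    qed
  qed
  moreover have "real k * (real k - 1) + c\<^sup>2 \<le> l" using k' \<open>c\<^sup>2 > 0\<close> by linarith
  moreover have "\<bar>legendre_coeff f 0\<bar> \<le> 1 / sqrt 2 * M"
    using I0 by (simp add: legendre_coeff_eq abs_mult real_sqrt_divide divide_right_mono)
  ultimately show "let q = c\<^sup>2 / chi n in
      \<bar>legendre_coeff (psi n) 0\<bar> \<le> 1 / sqrt 2 * cmod (mu n) \<and>
      \<bar>legendre_coeff (psi n) k\<bar> \<le> sqrt (5 / (4 * pi)) * (2 / sqrt q) ^ k * cmod (mu n)"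
    using \<open>k > 0\<close> unfolding Let_def f_def l_def M_def K_def r_def by blast
qed

end
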